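(* Let $\mathcal{G}$ be a connected simple weighted graph with $n$ nodes and $m$ edges, with incidence matrix $C$, positive diagonal matrices $M$ (inertias) and $B$ (susceptances), and damping matrix $D=\gamma M$ with $\gamma>0$. Let $L=M^{-1/2}CBC^TM^{-1/2}$ have eigenvalues $0=\lambda_1<\lambda_2\le\cdots\le\lambda_n$ with corresponding orthonormal eigenvectors $v_1,\dots,v_n$. For each $i\in\{1,\dots,n\}$ with $\gamma^2-4\lambda_i\neq0$, the $i$-th spectral transfer function of the system $$\dot x=\begin{bmatrix}-M^{-1}D & -M^{-1}C\\ BC^T & 0\end{bmatrix}x+\begin{bmatrix}M^{-1}\\0\end{bmatrix}s(t),\qquad x=[\omega;P],$$ is given by $$H_i(\tau)=\frac{\tau}{\tau^2+\gamma\tau+\lambda_i}.$$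
   Context: $\mathcal{G}=(\mathcal{N},\mathcal{E})$ with $\mathcal{N}=\{1,\dots,n\}$ is a connected simple graph with $|\mathcal{E}|=m$ edges, each given an arbitrary orientation. The incidence matrix $C\in\mathbb{R}^{n\times m}$ has $C_{je}=1$ if node $j$ is the source of $e$, $C_{je}=-1$ if $j$ is the target of $e$, and $0$ otherwise. $B$ is the $m\times m$ diagonal matrix of edge weights $B_{ij}>0$ (line susceptances); $M$ and $D$ are $n\times n$ diagonal matrices with entries $M_j>0$ and $D_j$, where the ratio $D_j/M_j=\gamma>0$ does not depend on $j$. $[a;b]$ denotes stacking $a$ on top of $b$ in a column. Spectral transfer function: let $\tau\in\mathbb{C}$ with $\tau^2+\gamma\tau+\lambda_i\ne0$. Apply the input $s(t)=e^{\tau t}M^{1/2}v_i$ to the system started at $x(0)=0$ (complex-valued states are allowed). The $i$-th spectral transfer function is the complex-valued function $H_i(\tau)$ such that the steady-state frequency trajectory is $\overline{\omega}(t)=H_i(\tau)e^{\tau t}M^{-1/2}v_i$. Here "steady-state" means the part of $\omega(t)$ that remains after dropping the transient terms, i.e. $\omega(t)=H_i(\tau)e^{\tau t}M^{-1/2}v_i+\left(a\,e^{\phi_{i,+}t}+b\,e^{\phi_{i,-}t}\right)M^{-1/2}v_i$ for some constants $a,b\in\mathbb{C}$ (depending on $\tau$ and $i$), where $\phi_{i,\pm}=\frac{-\gamma\pm\sqrt{\gamma^2-4\lambda_i}}{2}$ are the roots of $\tau^2+\gamma\tau+\lambda_i$. *)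

theory Defs
  imports Complex_Main
    "Jordan_Normal_Form.Matrix"
    "Jordan_Normal_Form.Char_Poly"
    "Graph_Theory.Digraph"
    "Graph_Theory.Digraph_Component"
begin

text \<open>
  A simple graph with an arbitrary orientation of its edges is represented by a digraph
  whose nodes are \<open>0,\<dots>,n-1\<close> and whose arcs are the edges \<open>0,\<dots>,m-1\<close>.
  The locale \<open>digraph\<close> only excludes loops and parallel arcs with equal direction, so
  antiparallel arcs have to be excluded separately.
\<close>

definition oriented_simple_graph :: "nat \<Rightarrow> nat \<Rightarrow> (nat, nat) pre_digraph \<Rightarrow> bool" where
  "oriented_simple_graph n m G \<longleftrightarrow>
     digraph G \<and> verts G = {..<n} \<and> arcs G = {..<m} \<and>
     (\<forall>e\<in>arcs G. \<forall>f\<in>arcs G. \<not> (tail G e = head G f \<and> head G e = tail G f))"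

definition incidence_mat :: "nat \<Rightarrow> nat \<Rightarrow> (nat, nat) pre_digraph \<Rightarrow> real mat" where
  "incidence_mat n m G =
     mat n m (\<lambda>(j, e). if j = tail G e then 1 else if j = head G e then -1 else 0)"

definition pos_diagonal_mat :: "nat \<Rightarrow> real mat \<Rightarrow> bool" where
  "pos_diagonal_mat n A \<longleftrightarrow>
     A \<in> carrier_mat n n \<and> diagonal_mat A \<and> (\<forall>j<n. A $$ (j, j) > 0)"

text \<open>Real powers of a diagonal matrix with positive diagonal.\<close>

definition diag_powr :: "real mat \<Rightarrow> real \<Rightarrow> real mat" where
  "diag_powr A a =
     mat (dim_row A) (dim_col A) (\<lambda>(j, k). if j = k then A $$ (j, j) powr a else 0)"

definition scaled_laplacian :: "real mat \<Rightarrow> real mat \<Rightarrow> real mat \<Rightarrow> real mat" where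
  "scaled_laplacian M B C =
     diag_powr M (-1/2) * C * B * transpose_mat C * diag_powr M (-1/2)"

definition system_mat :: "real mat \<Rightarrow> real mat \<Rightarrow> real mat \<Rightarrow> real mat \<Rightarrow> real mat" where
  "system_mat M D B C =
     four_block_mat (- (diag_powr M (-1) * D)) (- (diag_powr M (-1) * C))
                    (B * transpose_mat C)      (0\<^sub>m (dim_col C) (dim_col C))"

definition input_mat :: "real mat \<Rightarrow> real mat \<Rightarrow> real mat" where
  "input_mat M C = diag_powr M (-1) @\<^sub>r 0\<^sub>m (dim_col C) (dim_row C)"

text \<open>
  \<open>zero_state_response M D B C s \<omega> P\<close>: the state \<open>x = [\<omega>; P]\<close>, possibly complex-valued, solves
  the system with input \<open>s\<close> for all times \<open>t \<ge> 0\<close> and starts at \<open>x(0) = 0\<close>. The derivative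
  is taken componentwise because the vector type carries no topology; at \<open>t = 0\<close> it is one-sided.
\<close>

definition zero_state_response ::
  "real mat \<Rightarrow> real mat \<Rightarrow> real mat \<Rightarrow> real mat \<Rightarrow> (real \<Rightarrow> complex vec) \<Rightarrow>
   (real \<Rightarrow> complex vec) \<Rightarrow> (real \<Rightarrow> complex vec) \<Rightarrow> bool" where
  "zero_state_response M D B C s \<omega> P \<longleftrightarrow>
     (let n = dim_row C; m = dim_col C; x = (\<lambda>t. \<omega> t @\<^sub>v P t) in
       (\<forall>t\<ge>0. \<omega> t \<in> carrier_vec n \<and> P t \<in> carrier_vec m) \<and>
       x 0 = 0\<^sub>v (n + m) \<and>
       (\<forall>t\<ge>0. \<forall>k<n + m.
          ((\<lambda>u. x u $ k) has_vector_derivative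
             (map_mat complex_of_real (system_mat M D B C) *\<^sub>v x t +
              map_mat complex_of_real (input_mat M C) *\<^sub>v s t) $ k)
          (at t within {0..})))"

text \<open>The roots of \<open>\<tau>\<^sup>2 + \<gamma> \<tau> + l\<close>.\<close>

definition root_plus :: "real \<Rightarrow> real \<Rightarrow> complex" where
  "root_plus \<gamma> l = (- of_real \<gamma> + csqrt (of_real (\<gamma>\<^sup>2 - 4 * l))) / 2"

definition root_minus :: "real \<Rightarrow> real \<Rightarrow> complex" where
  "root_minus \<gamma> l = (- of_real \<gamma> - csqrt (of_real (\<gamma>\<^sup>2 - 4 * l))) / 2"

text \<open>
  \<open>H\<close> is a spectral transfer function for the eigenpair \<open>(l, v)\<close>: at each admissible \<open>\<tau>\<close>, the
  response to the input \<open>e\<^sup>\<tau>\<^sup>t M\<^sup>1\<^sup>/\<^sup>2 v\<close> exists, and its frequency part has steady state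
  \<open>H(\<tau>) e\<^sup>\<tau>\<^sup>t M\<^sup>-\<^sup>1\<^sup>/\<^sup>2 v\<close>, i.e. equals it up to transient terms. Nothing is said about the value
  of \<open>H\<close> at the two excluded points.
\<close>

definition is_spectral_transfer_function ::
  "real mat \<Rightarrow> real mat \<Rightarrow> real mat \<Rightarrow> real mat \<Rightarrow> real \<Rightarrow> real \<Rightarrow> real vec \<Rightarrow>
   (complex \<Rightarrow> complex) \<Rightarrow> bool" where
  "is_spectral_transfer_function M D B C \<gamma> l v H \<longleftrightarrow>
     (\<forall>\<tau>::complex. \<tau>\<^sup>2 + of_real \<gamma> * \<tau> + of_real l \<noteq> 0 \<longrightarrow>
       (let s = (\<lambda>t::real. exp (\<tau> * of_real t) \<cdot>\<^sub>v
                   map_vec complex_of_real (diag_powr M (1/2) *\<^sub>v v));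
            u = map_vec complex_of_real (diag_powr M (-1/2) *\<^sub>v v)
        in (\<exists>\<omega> P. zero_state_response M D B C s \<omega> P) \<and>
           (\<forall>\<omega> P. zero_state_response M D B C s \<omega> P \<longrightarrow>
             (\<exists>a b::complex. \<forall>t\<ge>0.
                \<omega> t = (H \<tau> * exp (\<tau> * of_real t)) \<cdot>\<^sub>v u +
                      (a * exp (root_plus \<gamma> l * of_real t) +
                       b * exp (root_minus \<gamma> l * of_real t)) \<cdot>\<^sub>v u))))"

end

theory Submission
  imports Defs
begin

text \<open>
  With \<open>u = M\<^sup>-\<^sup>1\<^sup>/\<^sup>2 v\<close> and \<open>w = B C\<^sup>T u\<close>, the ansatz \<open>\<omega> = f u\<close>, \<open>P = g w\<close> reduces the system to
  \<open>g' = f\<close>, \<open>f' = - \<gamma> f - \<lambda> g + e\<^sup>\<tau>\<^sup>t\<close>. Its solution with zero initial values is the divided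
  difference \<open>g\<close> of \<open>z \<mapsto> e\<^sup>z\<^sup>t\<close> at \<open>\<tau>\<close> and the two roots of the characteristic polynomial. A Gronwall
  estimate for the squared norm shows that there is no other response, and the linear independence
  of the three exponentials makes the coefficient of \<open>e\<^sup>\<tau>\<^sup>t\<close> in \<open>f = g'\<close> unambiguous.
\<close>

section \<open>Uniqueness for homogeneous linear systems; independence of exponentials\<close>

text \<open>The squared norm \<open>E\<close> grows at most at the exponential rate
  \<open>2 * K\<close>, so starting from zero it stays zero. The lemma is meant for differences of
  two solutions with the same input.\<close>

lemma linear_system_zero_unique:
  fixes x :: "nat \<Rightarrow> real \<Rightarrow> complex" and a :: "nat \<Rightarrow> nat \<Rightarrow> complex"
  assumes der: "\<And>t k. t \<ge> 0 \<Longrightarrow> k < N \<Longrightarrow>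
      (x k has_vector_derivative (\<Sum>j<N. a k j * x j t)) (at t within {0..})"
    and init: "\<And>k. k < N \<Longrightarrow> x k 0 = 0"
    and "t \<ge> 0" "k < N"
  shows "x k t = 0"
proof -
  \<comment> \<open>The sum of the moduli of all coefficients is a crude bound, but any finite
    growth rate suffices.\<close>
  define K where "K = (\<Sum>k<N. \<Sum>j<N. norm (a k j))"
  \<comment> \<open>Real and imaginary parts give access to real differentiation;
    \<open>E_norm\<close> returns to moduli for the estimates.\<close>
  define E where "E t = (\<Sum>k<N. (Re (x k t))\<^sup>2 + (Im (x k t))\<^sup>2)" for t
  define E' where "E' t = (\<Sum>k<N. 2 * Re (cnj (x k t) * (\<Sum>j<N. a k j * x j t)))" for t
  have E_norm: "E t = (\<Sum>k<N. (norm (x k t))\<^sup>2)" for t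
    by (simp add: E_def cmod_power2)
  have E_nonneg: "E t \<ge> 0" for t
    by (simp add: E_norm sum_nonneg)
  have E_deriv: "(E has_real_derivative E' t) (at t within {0..})" if "t \<ge> 0" for t
  proof -
    have "((\<lambda>t. (Re (x k t))\<^sup>2 + (Im (x k t))\<^sup>2) has_real_derivative
        2 * Re (cnj (x k t) * (\<Sum>j<N. a k j * x j t))) (at t within {0..})" if "k < N" for k
    proof -
      have d: "(x k has_vector_derivative (\<Sum>j<N. a k j * x j t)) (at t within {0..})"
        using der \<open>t \<ge> 0\<close> that by blast
      have "((\<lambda>t. Re (x k t)) has_real_derivative Re (\<Sum>j<N. a k j * x j t)) (at t within {0..})"
           "((\<lambda>t. Im (x k t)) has_real_derivative Im (\<Sum>j<N. a k j * x j t)) (at t within {0..})"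
        using bounded_linear.has_vector_derivative[OF bounded_linear_Re d]
          bounded_linear.has_vector_derivative[OF bounded_linear_Im d]
        by (simp_all add: has_real_derivative_iff_has_vector_derivative)
      moreover have "((\<lambda>t. (f t)\<^sup>2 + (g t)\<^sup>2) has_real_derivative 2 * (f t * f' + g t * g')) (at t within S)"
        if "(f has_real_derivative f') (at t within S)" "(g has_real_derivative g') (at t within S)"
        for f g :: "real \<Rightarrow> real" and f' g' S
        using that by (auto intro!: derivative_eq_intros simp: algebra_simps)
      ultimately show ?thesis
        by (simp del: Re_sum Im_sum)
    qed
    then show ?thesis
      unfolding E_def E'_def by (auto intro!: DERIV_sum)
  qed
  have E'_le: "E' t \<le> 2 * K * E t" for t
  proof -
    have le: "(norm (x k t))\<^sup>2 \<le> E t" if "k < N" for k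
      unfolding E_norm using that by (intro member_le_sum) auto
    have "2 * Re (cnj (x k t) * (\<Sum>j<N. a k j * x j t)) \<le> (\<Sum>j<N. norm (a k j) * (2 * E t))"
      if "k < N" for k
    proof -
      have "Re (cnj (x k t) * (\<Sum>j<N. a k j * x j t))
          \<le> norm (\<Sum>j<N. cnj (x k t) * (a k j * x j t))"
        unfolding sum_distrib_left[symmetric] by (rule complex_Re_le_cmod)
      also have "\<dots> \<le> (\<Sum>j<N. norm (a k j) * (norm (x k t) * norm (x j t)))"
        by (rule order_trans[OF norm_sum]) (simp add: norm_mult mult_ac)
      also have "\<dots> \<le> (\<Sum>j<N. norm (a k j) * E t)"
      \<comment> \<open>A product of two moduli is at most the mean of their squares, and each
        square is a summand of \<open>E t\<close>.\<close>
      proof (intro sum_mono mult_left_mono)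
        fix j assume "j \<in> {..<N}"
        then have "(norm (x k t))\<^sup>2 \<le> E t" "(norm (x j t))\<^sup>2 \<le> E t"
          using le that by auto
        then show "norm (x k t) * norm (x j t) \<le> E t"
          using sum_squares_bound[of "norm (x k t)" "norm (x j t)"] by linarith
      qed simp
      also have "\<dots> = (\<Sum>j<N. norm (a k j) * (2 * E t)) / 2"
        by (simp add: sum_divide_distrib)
      finally show ?thesis
        by linarith
    qed
    then have "E' t \<le> (\<Sum>k<N. \<Sum>j<N. norm (a k j) * (2 * E t))"
      unfolding E'_def by (intro sum_mono) auto
    also have "\<dots> = 2 * K * E t"
      by (simp add: K_def sum_distrib_left sum_distrib_right mult_ac)
    finally show ?thesis .
  qed
  \<comment> \<open>Integrating factor: by \<open>E'_le\<close> the derivative of \<open>F\<close>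
    is nonpositive.\<close>
  define F where "F t = exp (- (2 * K) * t) * E t" for t
  have F_deriv: "(F has_real_derivative exp (- (2 * K) * t) * (E' t - 2 * K * E t)) (at t within {0..})"
    if "t \<ge> 0" for t
    unfolding F_def by (auto intro!: derivative_eq_intros E_deriv that simp: algebra_simps)
  have "F t \<le> F 0"
  proof (rule DERIV_nonpos_imp_decreasing_open[where f = F and a = 0 and b = t])
    show "0 \<le> t" by fact
    show "\<exists>y. (F has_real_derivative y) (at s) \<and> y \<le> 0" if "0 < s" "s < t" for s
    proof -
      \<comment> \<open>The system only gives derivatives within the closed half-line. At interior
        times these are two-sided; at \<open>0\<close> continuity is enough.\<close>
      have "at s within {0..} = at s"
        by (rule at_within_open_subset[of s "{0<..}"]) (use that in auto)
      then have "(F has_real_derivative exp (- (2 * K) * s) * (E' s - 2 * K * E s)) (at s)"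
        using F_deriv[of s] that by simp
      moreover have "exp (- (2 * K) * s) * (E' s - 2 * K * E s) \<le> 0"
        using E'_le[of s] by (intro mult_nonneg_nonpos) auto
      ultimately show ?thesis by blast
    qed
    have "continuous_on {0..} F"
      using F_deriv DERIV_continuous unfolding continuous_on_eq_continuous_within
      by (metis atLeast_iff)
    then show "continuous_on {0..t} F"
      by (rule continuous_on_subset) auto
  qed
  also have "F 0 = 0"
    by (simp add: F_def E_def init)
  finally have "E t \<le> 0"
    by (simp add: F_def mult_le_0_iff)
  then have "E t = 0"
    using E_nonneg[of t] by simp
  then show ?thesis
    using \<open>k < N\<close> by (simp add: E_norm sum_nonneg_eq_0_iff)
qed

lemma exp_has_vector_derivative:
  "((\<lambda>t. exp (c * of_real t)) has_vector_derivative c * exp (c * of_real t)) (at t within S)"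
  for c :: complex
proof -
  have "((\<lambda>z. exp (c * z)) has_field_derivative c * exp (c * of_real t)) (at (of_real t))"
    by (auto intro!: derivative_eq_intros)
  then show ?thesis
    by (rule has_vector_derivative_real_field)
qed

text \<open>The operator (d/dt - \<beta>)(d/dt - \<delta>) kills the second and third terms and
  multiplies the first by (\<alpha> - \<beta>)(\<alpha> - \<delta>), which is nonzero.\<close>

lemma three_exp_independent:
  fixes \<alpha> \<beta> \<delta> :: complex
  assumes "\<alpha> \<noteq> \<beta>" "\<alpha> \<noteq> \<delta>"
    and zero: "\<And>t::real. t > 0 \<Longrightarrow>
      p * exp (\<alpha> * of_real t) + q * exp (\<beta> * of_real t) + r * exp (\<delta> * of_real t) = 0"
  shows "p = 0"
proof -
  let ?F = "\<lambda>p q r t. p * exp (\<alpha> * complex_of_real t) + q * exp (\<beta> * of_real t)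
      + r * exp (\<delta> * of_real t)"
  have step: "?F (p * \<alpha>) (q * \<beta>) (r * \<delta>) t = 0"
    if "\<And>t. t > 0 \<Longrightarrow> ?F p q r t = 0" "t > 0" for p q r and t :: real
  proof -
    have "(?F p q r has_vector_derivative ?F (p * \<alpha>) (q * \<beta>) (r * \<delta>) t) (at t)"
      by (auto intro!: derivative_eq_intros exp_has_vector_derivative)
    \<comment> \<open>On the open half-line the combination agrees with the zero function, so
      uniqueness of derivatives makes the differentiated combination vanish too.\<close>
    then have "((\<lambda>_. 0) has_vector_derivative ?F (p * \<alpha>) (q * \<beta>) (r * \<delta>) t) (at t)"
      unfolding has_vector_derivative_def
      by (rule has_derivative_transform_within_open[where s = "{0<..}"]) (use that in auto)
    then have "(\<lambda>h. h *\<^sub>R ?F (p * \<alpha>) (q * \<beta>) (r * \<delta>) t) = (\<lambda>_. 0)"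
      unfolding has_vector_derivative_def by (rule has_derivative_unique) simp
    from fun_cong[OF this, of 1] show ?thesis
      by simp
  qed
  have "?F p q r t = 0" "?F (p * \<alpha>) (q * \<beta>) (r * \<delta>) t = 0"
    "?F (p * \<alpha> * \<alpha>) (q * \<beta> * \<beta>) (r * \<delta> * \<delta>) t = 0" if "t > 0" for t
    using that by (auto intro!: step zero)
  note this[of 1, simplified]
  \<comment> \<open>The three rows are the relation and its first two derivatives at time 1,
    weighted by the coefficients of (z - \<beta>)(z - \<delta>).\<close>
  moreover have "p * exp \<alpha> * ((\<alpha> - \<beta>) * (\<alpha> - \<delta>)) =
      (p * \<alpha> * \<alpha> * exp \<alpha> + q * \<beta> * \<beta> * exp \<beta> + r * \<delta> * \<delta> * exp \<delta>)
      - (\<beta> + \<delta>) * (p * \<alpha> * exp \<alpha> + q * \<beta> * exp \<beta> + r * \<delta> * exp \<delta>)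
      + \<beta> * \<delta> * (p * exp \<alpha> + q * exp \<beta> + r * exp \<delta>)"
    by (simp add: algebra_simps)
  ultimately have "p * exp \<alpha> * ((\<alpha> - \<beta>) * (\<alpha> - \<delta>)) = 0"
    by simp
  then show ?thesis
    using assms by simp
qed


section \<open>Matrix-vector products and powers of a positive diagonal matrix\<close>

lemma smult_mat_mult_vec:
  fixes A :: "'a :: comm_semiring_0 mat"
  assumes "dim_vec v = dim_col A"
  shows "(c \<cdot>\<^sub>m A) *\<^sub>v v = c \<cdot>\<^sub>v (A *\<^sub>v v)"
  using assms by (intro eq_vecI) (auto simp: scalar_prod_def sum_distrib_left mult.assoc)

lemma mult_mat_vec_zero: "A \<in> carrier_mat nr nc \<Longrightarrow> A *\<^sub>v 0\<^sub>v nc = 0\<^sub>v nr"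
  by (intro eq_vecI) auto

lemma zero_mat_mult_vec: "v \<in> carrier_vec nc \<Longrightarrow> 0\<^sub>m nr nc *\<^sub>v v = 0\<^sub>v nr"
  by (intro eq_vecI) auto

lemma diag_powr_carrier: "pos_diagonal_mat n M \<Longrightarrow> diag_powr M a \<in> carrier_mat n n"
  by (auto simp: pos_diagonal_mat_def diag_powr_def)

lemma index_diag_powr_mult_vec:
  assumes "pos_diagonal_mat n M" "v \<in> carrier_vec n" "j < n"
  shows "(diag_powr M a *\<^sub>v v) $ j = M $$ (j, j) powr a * v $ j"
proof -
  have "(diag_powr M a *\<^sub>v v) $ j = (\<Sum>k\<in>{0..<n}. (if j = k then M $$ (j, j) powr a else 0) * v $ k)"
    using assms by (auto simp: pos_diagonal_mat_def diag_powr_def scalar_prod_def)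
  also have "\<dots> = (\<Sum>k\<in>{0..<n}. (if j = k then M $$ (j, j) powr a * v $ j else 0))"
    by (rule sum.cong) auto
  finally have "(diag_powr M a *\<^sub>v v) $ j = \<dots>" .
  then show ?thesis using \<open>j < n\<close> by simp
qed

lemma diag_powr_mult_vec_mult_vec:
  assumes "pos_diagonal_mat n M" "v \<in> carrier_vec n"
  shows "diag_powr M a *\<^sub>v (diag_powr M b *\<^sub>v v) = diag_powr M (a + b) *\<^sub>v v"
proof (rule eq_vecI)
  note car = diag_powr_carrier[OF assms(1)] mult_mat_vec_carrier[OF diag_powr_carrier[OF assms(1)] assms(2)]
  show "dim_vec (diag_powr M a *\<^sub>v (diag_powr M b *\<^sub>v v)) = dim_vec (diag_powr M (a + b) *\<^sub>v v)"
    by (simp add: diag_powr_def)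
  fix j assume "j < dim_vec (diag_powr M (a + b) *\<^sub>v v)"
  then have "j < n" using car(1)[of "a + b"] by simp
  then show "(diag_powr M a *\<^sub>v (diag_powr M b *\<^sub>v v)) $ j = (diag_powr M (a + b) *\<^sub>v v) $ j"
    using assms car by (simp add: index_diag_powr_mult_vec powr_add)
qed

lemma diag_powr_one: "pos_diagonal_mat n M \<Longrightarrow> diag_powr M 1 = M"
  by (rule eq_matI) (auto simp: pos_diagonal_mat_def diag_powr_def diagonal_mat_def)

lemma diag_powr_zero_mult_vec:
  assumes "pos_diagonal_mat n M" "v \<in> carrier_vec n"
  shows "diag_powr M 0 *\<^sub>v v = v"
proof (rule eq_vecI)
  show "dim_vec (diag_powr M 0 *\<^sub>v v) = dim_vec v"
    using assms diag_powr_carrier[OF assms(1)] by auto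
  fix j assume "j < dim_vec v"
  then have "j < n" using assms by auto
  \<comment> \<open>Since \<open>0 powr 0\<close> is \<open>0\<close>, the zeroth power acts as the
    identity only where the diagonal is nonzero.\<close>
  moreover from this have "M $$ (j, j) \<noteq> 0"
    using assms by (auto simp: pos_diagonal_mat_def)
  ultimately show "(diag_powr M 0 *\<^sub>v v) $ j = v $ j"
    using assms by (simp add: index_diag_powr_mult_vec)
qed

section \<open>Uniqueness of the zero state response\<close>

lemma system_mat_carrier:
  assumes "pos_diagonal_mat n M" "C \<in> carrier_mat n m" "D \<in> carrier_mat n n"
  shows "system_mat M D B C \<in> carrier_mat (n + m) (n + m)"
  using assms diag_powr_carrier[OF assms(1), of "-1"]
  by (auto simp: system_mat_def)

text \<open>The input cancels in the difference of two responses, which therefore solves the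
  homogeneous system with zero initial state.\<close>

lemma zero_state_response_unique:
  assumes M: "pos_diagonal_mat n M" and C: "C \<in> carrier_mat n m" and D: "D \<in> carrier_mat n n"
    and r1: "zero_state_response M D B C s \<omega>\<^sub>1 P\<^sub>1"
    and r2: "zero_state_response M D B C s \<omega>\<^sub>2 P\<^sub>2"
    and "t \<ge> 0"
  shows "\<omega>\<^sub>1 t = \<omega>\<^sub>2 t"
proof -
  define A where "A = map_mat complex_of_real (system_mat M D B C)"
  define x where "x k t = (\<omega>\<^sub>1 t @\<^sub>v P\<^sub>1 t) $ k - (\<omega>\<^sub>2 t @\<^sub>v P\<^sub>2 t) $ k" for k t
  have A: "A \<in> carrier_mat (n + m) (n + m)"
    using system_mat_carrier[OF M C D] by (simp add: A_def)
  have car: "\<omega>\<^sub>1 t \<in> carrier_vec n" "P\<^sub>1 t \<in> carrier_vec m"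
    "\<omega>\<^sub>2 t \<in> carrier_vec n" "P\<^sub>2 t \<in> carrier_vec m" if "t \<ge> 0" for t
    using r1 r2 C that by (auto simp: zero_state_response_def Let_def)
  have zero: "x k t = 0" if "k < n + m" for k
  proof (rule linear_system_zero_unique[where x = x and N = "n + m" and a = "\<lambda>k j. A $$ (k, j)"])
    show "x k 0 = 0" if "k < n + m" for k
      using r1 r2 C that by (simp add: x_def zero_state_response_def)
    show "(x k has_vector_derivative (\<Sum>j<n + m. A $$ (k, j) * x j t)) (at t within {0..})"
      if "t \<ge> 0" "k < n + m" for t k
    proof -
      let ?b = "(map_mat complex_of_real (input_mat M C) *\<^sub>v s t)"
      have prod: "(A *\<^sub>v y + ?b) $ k = (\<Sum>j<n + m. A $$ (k, j) * y $ j) + ?b $ k"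
        if "y \<in> carrier_vec (n + m)" for y
        using that A \<open>k < n + m\<close> C diag_powr_carrier[OF M, of "-1"]
        by (auto simp: scalar_prod_def input_mat_def append_rows_def lessThan_atLeast0 intro!: sum.cong)
      have "(x k has_vector_derivative (A *\<^sub>v (\<omega>\<^sub>1 t @\<^sub>v P\<^sub>1 t) + ?b) $ k
          - (A *\<^sub>v (\<omega>\<^sub>2 t @\<^sub>v P\<^sub>2 t) + ?b) $ k) (at t within {0..})"
        unfolding x_def A_def using r1 r2 C that
        by (intro has_vector_derivative_diff) (auto simp: zero_state_response_def Let_def)
      also have "(A *\<^sub>v (\<omega>\<^sub>1 t @\<^sub>v P\<^sub>1 t) + ?b) $ k - (A *\<^sub>v (\<omega>\<^sub>2 t @\<^sub>v P\<^sub>2 t) + ?b) $ k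
          = (\<Sum>j<n + m. A $$ (k, j) * x j t)"
        using car[OF \<open>t \<ge> 0\<close>] by (simp add: prod x_def right_diff_distrib flip: sum_subtractf)
      finally show ?thesis .
    qed
  qed (use \<open>t \<ge> 0\<close> that in auto)
  have "\<omega>\<^sub>1 t $ k = \<omega>\<^sub>2 t $ k" if "k < n" for k
    using zero[of k] car[OF \<open>t \<ge> 0\<close>] that by (simp add: x_def)
  then show ?thesis
    using car[OF \<open>t \<ge> 0\<close>] by (intro eq_vecI) auto
qed

section \<open>Reduction of the system to one mode\<close>

text \<open>The plane spanned by \<open>[u; 0]\<close> and \<open>[0; w]\<close> is invariant under
  the system matrix and contains the input direction. In these coordinates the system is the pair of
  scalar equations assumed for \<open>f\<close> and \<open>g\<close>.\<close>

lemma modal_response: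
  assumes M: "pos_diagonal_mat n M" and B: "B \<in> carrier_mat m m" and C: "C \<in> carrier_mat n m"
    and v: "v \<in> carrier_vec n" and eig: "scaled_laplacian M B C *\<^sub>v v = l \<cdot>\<^sub>v v"
    and f: "\<And>t. t \<ge> 0 \<Longrightarrow> (f has_vector_derivative \<sigma> t - of_real \<gamma> * f t - of_real l * g t) (at t within {0..})"
    and g: "\<And>t. t \<ge> 0 \<Longrightarrow> (g has_vector_derivative f t) (at t within {0..})"
    and "f 0 = 0" "g 0 = 0"
  defines "u \<equiv> diag_powr M (-1/2) *\<^sub>v v"
  defines "w \<equiv> B *\<^sub>v (transpose_mat C *\<^sub>v u)"
  shows "zero_state_response M (\<gamma> \<cdot>\<^sub>m M) B C
      (\<lambda>t. \<sigma> t \<cdot>\<^sub>v map_vec complex_of_real (diag_powr M (1/2) *\<^sub>v v))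
      (\<lambda>t. f t \<cdot>\<^sub>v map_vec complex_of_real u) (\<lambda>t. g t \<cdot>\<^sub>v map_vec complex_of_real w)"
proof -
  let ?A = "system_mat M (\<gamma> \<cdot>\<^sub>m M) B C"
  let ?v = "diag_powr M (1/2) *\<^sub>v v"
  note dp = diag_powr_carrier[OF M]
  have Mc: "M \<in> carrier_mat n n" using M by (simp add: pos_diagonal_mat_def)
  have Ct: "transpose_mat C \<in> carrier_mat m n" using C by simp
  have u: "u \<in> carrier_vec n" unfolding u_def by (rule mult_mat_vec_carrier[OF dp v])
  have w: "w \<in> carrier_vec m" unfolding w_def
    by (rule mult_mat_vec_carrier[OF B mult_mat_vec_carrier[OF Ct u]])
  have v': "?v \<in> carrier_vec n" by (rule mult_mat_vec_carrier[OF dp v])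
  have A: "?A \<in> carrier_mat (n + m) (n + m)"
    using system_mat_carrier[OF M C] Mc by simp
  have I: "input_mat M C \<in> carrier_mat (n + m) n"
    using C dp[of "-1"] by (auto simp: input_mat_def)
  have damp: "diag_powr M (-1) * (\<gamma> \<cdot>\<^sub>m M) *\<^sub>v u = \<gamma> \<cdot>\<^sub>v u"
  proof -
    have "M *\<^sub>v u = diag_powr M 1 *\<^sub>v u" by (simp add: diag_powr_one[OF M])
    then have "diag_powr M (-1) *\<^sub>v (M *\<^sub>v u) = u"
      using diag_powr_mult_vec_mult_vec[OF M u, of "-1" 1] diag_powr_zero_mult_vec[OF M u] by simp
    then show ?thesis
      using mult_mat_vec[OF dp mult_mat_vec_carrier[OF Mc u]] Mc u dp
      by (simp add: assoc_mult_mat_vec[OF dp _ u] smult_mat_mult_vec)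
  qed
  \<comment> \<open>Since w = B C^T M^(-1/2) v, the left side is M^(-1/2) applied to L v = l
    v.\<close>
  have stiff: "diag_powr M (-1) * C *\<^sub>v w = l \<cdot>\<^sub>v u"
  proof -
    have c1: "C *\<^sub>v w \<in> carrier_vec n" by (rule mult_mat_vec_carrier[OF C w])
    have "l \<cdot>\<^sub>v v = diag_powr M (-1/2) *\<^sub>v (C *\<^sub>v w)"
    proof -
      let ?N = "diag_powr M (-1/2)"
      have N: "?N \<in> carrier_mat n n" by (rule dp)
      have NC: "?N * C \<in> carrier_mat n m" and NCB: "?N * C * B \<in> carrier_mat n m"
        and NCBC: "?N * C * B * transpose_mat C \<in> carrier_mat n n"
        using N C B Ct by auto
      show ?thesis
        unfolding eig[symmetric] scaled_laplacian_def w_def assoc_mult_mat_vec[OF NCBC N v]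
          u_def[symmetric] assoc_mult_mat_vec[OF NCB Ct u]
          assoc_mult_mat_vec[OF NC B mult_mat_vec_carrier[OF Ct u]]
        by (rule assoc_mult_mat_vec[OF N C mult_mat_vec_carrier[OF B mult_mat_vec_carrier[OF Ct u]]])
    qed
    then have "diag_powr M (-1/2) *\<^sub>v (l \<cdot>\<^sub>v v) = diag_powr M (-1) *\<^sub>v (C *\<^sub>v w)"
      using diag_powr_mult_vec_mult_vec[OF M c1, of "-1/2" "-1/2"] by simp
    then show ?thesis
      unfolding assoc_mult_mat_vec[OF dp C w] u_def by (simp add: mult_mat_vec[OF dp v])
  qed
  have DM: "diag_powr M (-1) * (\<gamma> \<cdot>\<^sub>m M) \<in> carrier_mat n n"
    and CM: "diag_powr M (-1) * C \<in> carrier_mat n m" and BC: "B * transpose_mat C \<in> carrier_mat m n"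
    using dp[of "-1"] Mc B C by auto
  have A_mult: "?A *\<^sub>v (y @\<^sub>v z) =
      (- (diag_powr M (-1) * (\<gamma> \<cdot>\<^sub>m M) *\<^sub>v y) - diag_powr M (-1) * C *\<^sub>v z) @\<^sub>v
      (B *\<^sub>v (transpose_mat C *\<^sub>v y))"
    if "y \<in> carrier_vec n" "z \<in> carrier_vec m" for y z
  proof -
    have "?A *\<^sub>v (y @\<^sub>v z) =
        (- (diag_powr M (-1) * (\<gamma> \<cdot>\<^sub>m M)) *\<^sub>v y + - (diag_powr M (-1) * C) *\<^sub>v z) @\<^sub>v
        (B * transpose_mat C *\<^sub>v y + 0\<^sub>m m m *\<^sub>v z)"
      unfolding system_mat_def using DM CM BC C that
      by (subst four_block_mat_mult_vec[where ?nr1.0 = n and ?nc1.0 = n and ?nr2.0 = m and ?nc2.0 = m]) auto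
    moreover have "B *\<^sub>v (transpose_mat C *\<^sub>v y) \<in> carrier_vec m"
      by (rule mult_mat_vec_carrier[OF B mult_mat_vec_carrier[OF Ct that(1)]])
    moreover have "- (diag_powr M (-1) * (\<gamma> \<cdot>\<^sub>m M)) *\<^sub>v y = - (diag_powr M (-1) * (\<gamma> \<cdot>\<^sub>m M) *\<^sub>v y)"
      "- (diag_powr M (-1) * C) *\<^sub>v z = - (diag_powr M (-1) * C *\<^sub>v z)"
      using that DM CM by (auto intro!: uminus_mult_mat_vec)
    ultimately show ?thesis
      using that DM CM by (simp add: zero_mat_mult_vec assoc_mult_mat_vec[OF B Ct] minus_add_uminus_vec[of _ n] del: uminus_mult_mat_vec)
  qed
  \<comment> \<open>\<open>Au\<close> and \<open>Aw\<close> express the invariance of the plane.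
    They are proved over the reals and carried to complex scalars in \<open>rhs\<close>.\<close>
  have Au: "?A *\<^sub>v (u @\<^sub>v 0\<^sub>v m) = (- \<gamma> \<cdot>\<^sub>v u) @\<^sub>v w"
    using u by (simp add: A_mult damp mult_mat_vec_zero[OF CM] w_def) (auto intro!: eq_vecI)
  have Aw: "?A *\<^sub>v (0\<^sub>v n @\<^sub>v w) = (- l \<cdot>\<^sub>v u) @\<^sub>v 0\<^sub>v m"
    using u w by (simp add: A_mult stiff mult_mat_vec_zero[OF DM] mult_mat_vec_zero[OF Ct] mult_mat_vec_zero[OF B])
      (auto intro!: eq_vecI)
  \<comment> \<open>The factor M^(1/2) in the input is chosen so that M^(-1) M^(1/2) v = u: the
    input drives only this mode.\<close>
  have Iv: "input_mat M C *\<^sub>v ?v = u @\<^sub>v 0\<^sub>v m"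
  proof -
    have "input_mat M C *\<^sub>v ?v = (diag_powr M (-1) *\<^sub>v ?v) @\<^sub>v (0\<^sub>m m n *\<^sub>v ?v)"
      unfolding input_mat_def using C by (auto intro!: mat_mult_append[OF dp _ v'])
    then show ?thesis
      using diag_powr_mult_vec_mult_vec[OF M v, of "-1" "1/2"] by (simp add: zero_mat_mult_vec[OF v'] u_def)
  qed
  have rhs: "(map_mat complex_of_real ?A *\<^sub>v
        ((f t \<cdot>\<^sub>v map_vec complex_of_real u) @\<^sub>v (g t \<cdot>\<^sub>v map_vec complex_of_real w)) +
      map_mat complex_of_real (input_mat M C) *\<^sub>v (\<sigma> t \<cdot>\<^sub>v map_vec complex_of_real ?v)) $ k
    = (if k < n then (\<sigma> t - of_real \<gamma> * f t - of_real l * g t) * of_real (u $ k)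
       else f t * of_real (w $ (k - n)))" if "k < n + m" for t k
  proof -
    let ?h = "map_vec complex_of_real" and ?H = "map_mat complex_of_real"
    have car: "u @\<^sub>v 0\<^sub>v m \<in> carrier_vec (n + m)" "0\<^sub>v n @\<^sub>v w \<in> carrier_vec (n + m)"
      using u w by auto
    have "(f t \<cdot>\<^sub>v ?h u) @\<^sub>v (g t \<cdot>\<^sub>v ?h w) = f t \<cdot>\<^sub>v ?h (u @\<^sub>v 0\<^sub>v m) + g t \<cdot>\<^sub>v ?h (0\<^sub>v n @\<^sub>v w)"
      using u w by (intro eq_vecI) auto
    also have "?H ?A *\<^sub>v \<dots> = f t \<cdot>\<^sub>v (?H ?A *\<^sub>v ?h (u @\<^sub>v 0\<^sub>v m)) + g t \<cdot>\<^sub>v (?H ?A *\<^sub>v ?h (0\<^sub>v n @\<^sub>v w))"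
      using A car by (simp add: mult_add_distrib_mat_vec[where nc = "n + m" and nr = "n + m"]
          mult_mat_vec[where nc = "n + m" and nr = "n + m"])
    also have "\<dots> = f t \<cdot>\<^sub>v ?h ((- \<gamma> \<cdot>\<^sub>v u) @\<^sub>v w) + g t \<cdot>\<^sub>v ?h ((- l \<cdot>\<^sub>v u) @\<^sub>v 0\<^sub>v m)"
      by (simp only: of_real_hom.mult_mat_vec_hom[OF A car(1), symmetric]
          of_real_hom.mult_mat_vec_hom[OF A car(2), symmetric] Au Aw)
    finally have 1: "?H ?A *\<^sub>v ((f t \<cdot>\<^sub>v ?h u) @\<^sub>v (g t \<cdot>\<^sub>v ?h w)) = \<dots>" .
    have "?H (input_mat M C) *\<^sub>v (\<sigma> t \<cdot>\<^sub>v ?h ?v) = \<sigma> t \<cdot>\<^sub>v (?H (input_mat M C) *\<^sub>v ?h ?v)"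
      using I v' by (simp add: mult_mat_vec[where nc = n and nr = "n + m"])
    also have "\<dots> = \<sigma> t \<cdot>\<^sub>v ?h (u @\<^sub>v 0\<^sub>v m)"
      by (simp only: of_real_hom.mult_mat_vec_hom[OF I v', symmetric] Iv)
    finally show ?thesis
      unfolding 1 using u w that by (auto simp: algebra_simps)
  qed
  show ?thesis
    unfolding zero_state_response_def Let_def
  proof (intro conjI allI impI)
    fix t :: real and k assume "0 \<le> t" "k < dim_row C + dim_col C"
    then have k: "k < n + m" using C by simp
    \<comment> \<open>Each component is a scalar function times a fixed number, so the derivatives
      of \<open>f\<close> and \<open>g\<close> suffice.\<close>
    have x: "((f t \<cdot>\<^sub>v map_vec complex_of_real u) @\<^sub>v (g t \<cdot>\<^sub>v map_vec complex_of_real w)) $ k =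
        (if k < n then f t * of_real (u $ k) else g t * of_real (w $ (k - n)))" for t
      using u w k by auto
    show "((\<lambda>t. ((f t \<cdot>\<^sub>v map_vec complex_of_real u) @\<^sub>v (g t \<cdot>\<^sub>v map_vec complex_of_real w)) $ k)
        has_vector_derivative
        (map_mat complex_of_real ?A *\<^sub>v
          ((f t \<cdot>\<^sub>v map_vec complex_of_real u) @\<^sub>v (g t \<cdot>\<^sub>v map_vec complex_of_real w)) +
        map_mat complex_of_real (input_mat M C) *\<^sub>v (\<sigma> t \<cdot>\<^sub>v map_vec complex_of_real ?v)) $ k)
        (at t within {0..})"
      unfolding rhs[OF k] x
      by (auto intro!: has_vector_derivative_mult_left f g \<open>0 \<le> t\<close>)
  qed (use u w C \<open>f 0 = 0\<close> \<open>g 0 = 0\<close> in \<open>auto intro!: eq_vecI\<close>)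
qed

section \<open>The roots of the characteristic polynomial\<close>

lemma root_plus_add_root_minus: "root_plus \<gamma> l + root_minus \<gamma> l = - of_real \<gamma>"
  by (simp add: root_plus_def root_minus_def field_simps)

lemma root_plus_mult_root_minus: "root_plus \<gamma> l * root_minus \<gamma> l = of_real l"
proof -
  have "root_plus \<gamma> l * root_minus \<gamma> l =
      ((of_real \<gamma>)\<^sup>2 - (csqrt (of_real (\<gamma>\<^sup>2 - 4 * l)))\<^sup>2) / 4"
    by (simp add: root_plus_def root_minus_def power2_eq_square field_simps)
  then show ?thesis
    by (simp only: power2_csqrt) simp
qed

lemma root_plus_neq_root_minus:
  assumes "\<gamma>\<^sup>2 - 4 * l \<noteq> 0"
  shows "root_plus \<gamma> l \<noteq> root_minus \<gamma> l"
proof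
  assume "root_plus \<gamma> l = root_minus \<gamma> l"
  then have "csqrt (of_real (\<gamma>\<^sup>2 - 4 * l)) = 0"
    by (simp add: root_plus_def root_minus_def field_simps)
  then show False
    using assms by (metis csqrt_eq_0 of_real_eq_0_iff)
qed

text \<open>By Vieta. It turns admissibility of \<tau> into \<tau> being different from both
  roots.\<close>

lemma char_poly_factor:
  "\<tau>\<^sup>2 + of_real \<gamma> * \<tau> + of_real l = (\<tau> - root_plus \<gamma> l) * (\<tau> - root_minus \<gamma> l)"
proof -
  have "(\<tau> - root_plus \<gamma> l) * (\<tau> - root_minus \<gamma> l) =
      \<tau>\<^sup>2 - (root_plus \<gamma> l + root_minus \<gamma> l) * \<tau> + root_plus \<gamma> l * root_minus \<gamma> l"
    by (simp add: algebra_simps power2_eq_square)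
  then show ?thesis
    by (simp add: root_plus_add_root_minus root_plus_mult_root_minus)
qed

section \<open>The transfer function of one eigenpair\<close>

text \<open>An equivalence gives both that the formula is a transfer function and that no other
  values are possible at admissible points. At the two roots both sides leave \<open>H\<close>
  free.\<close>

lemma spectral_transfer_function_iff:
  assumes M: "pos_diagonal_mat n M" and B: "B \<in> carrier_mat m m" and C: "C \<in> carrier_mat n m"
    and ev: "eigenvector (scaled_laplacian M B C) v l"
    and disc: "\<gamma>\<^sup>2 - 4 * l \<noteq> 0"
  shows "is_spectral_transfer_function M (\<gamma> \<cdot>\<^sub>m M) B C \<gamma> l v H \<longleftrightarrow>
    (\<forall>\<tau>. \<tau>\<^sup>2 + of_real \<gamma> * \<tau> + of_real l \<noteq> 0 \<longrightarrow>
      H \<tau> = \<tau> / (\<tau>\<^sup>2 + of_real \<gamma> * \<tau> + of_real l))"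
proof -
  let ?r = "root_plus \<gamma> l" and ?s = "root_minus \<gamma> l"
  define u where "u = map_vec complex_of_real (diag_powr M (-1/2) *\<^sub>v v)"
  have "dim_row (scaled_laplacian M B C) = n"
    using diag_powr_carrier[OF M, of "-1/2"] by (auto simp: scaled_laplacian_def)
  then have v: "v \<in> carrier_vec n" "v \<noteq> 0\<^sub>v n" and eig: "scaled_laplacian M B C *\<^sub>v v = l \<cdot>\<^sub>v v"
    using ev by (auto simp: eigenvector_def)
  \<comment> \<open>A component where \<open>v\<close>, hence also \<open>u\<close>, is nonzero; it
    later allows multiples of \<open>u\<close> to be compared through their scalar factors.\<close>
  then obtain j where j: "j < n" "v $ j \<noteq> 0"
    by (metis carrier_vecD eq_vecI index_zero_vec)
  have u: "u \<in> carrier_vec n"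
    using mult_mat_vec_carrier[OF diag_powr_carrier[OF M] v(1)] by (simp add: u_def)
  have uj: "u $ j \<noteq> 0"
  proof -
    have "M $$ (j, j) \<noteq> 0"
      using M j by (auto simp: pos_diagonal_mat_def)
    moreover have "u $ j = of_real ((diag_powr M (-1/2) *\<^sub>v v) $ j)"
      using j diag_powr_carrier[OF M, of "-1/2"] by (simp add: u_def)
    ultimately show ?thesis
      using j index_diag_powr_mult_vec[OF M v(1) j(1), of "-1/2"] by simp
  qed
  \<comment> \<open>The defining condition is treated separately for each \<tau>; this is its clause
    at one admissible point.\<close>
  have "(let s = (\<lambda>t::real. exp (\<tau> * of_real t) \<cdot>\<^sub>v map_vec complex_of_real (diag_powr M (1/2) *\<^sub>v v));
            u = map_vec complex_of_real (diag_powr M (-1/2) *\<^sub>v v)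
        in (\<exists>\<omega> P. zero_state_response M (\<gamma> \<cdot>\<^sub>m M) B C s \<omega> P) \<and>
           (\<forall>\<omega> P. zero_state_response M (\<gamma> \<cdot>\<^sub>m M) B C s \<omega> P \<longrightarrow>
             (\<exists>a b::complex. \<forall>t\<ge>0.
                \<omega> t = (H \<tau> * exp (\<tau> * of_real t)) \<cdot>\<^sub>v u +
                      (a * exp (?r * of_real t) + b * exp (?s * of_real t)) \<cdot>\<^sub>v u))) \<longleftrightarrow>
        H \<tau> = \<tau> / ((\<tau> - ?r) * (\<tau> - ?s))" (is "?L \<longleftrightarrow> _")
    if "(\<tau> - ?r) * (\<tau> - ?s) \<noteq> 0" for \<tau>
  proof -
    have ne: "\<tau> \<noteq> ?r" "\<tau> \<noteq> ?s" "?r \<noteq> ?s"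
      using that root_plus_neq_root_minus[OF disc] by auto
    \<comment> \<open>Weights of the second divided difference at \<tau> and the two roots, which
      are three distinct nodes. \<open>G 0\<close> is the divided difference of z \<mapsto> e^(z t),
      and \<open>G k\<close> is its k-th time derivative.\<close>
    define c\<^sub>0 c\<^sub>1 c\<^sub>2 where "c\<^sub>0 = 1 / ((\<tau> - ?r) * (\<tau> - ?s))" and "c\<^sub>1 = 1 / ((?r - \<tau>) * (?r - ?s))"
      and "c\<^sub>2 = 1 / ((?s - \<tau>) * (?s - ?r))"
    define G where "G k t = c\<^sub>0 * \<tau> ^ k * exp (\<tau> * complex_of_real t) + c\<^sub>1 * ?r ^ k * exp (?r * of_real t)
        + c\<^sub>2 * ?s ^ k * exp (?s * of_real t)" for k t
    have G_deriv: "(G k has_vector_derivative G (Suc k) t) (at t within {0..})" for k t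
      unfolding G_def by (auto intro!: derivative_eq_intros exp_has_vector_derivative)
    \<comment> \<open>Second divided differences annihilate constants and linear functions. These
      are the initial values \<open>G 0 0 = 0\<close> and \<open>G 1 0 = 0\<close>.\<close>
    have sums: "c\<^sub>0 + c\<^sub>1 + c\<^sub>2 = 0" "c\<^sub>0 * \<tau> + c\<^sub>1 * ?r + c\<^sub>2 * ?s = 0"
    proof -
      \<comment> \<open>Used with x = \<tau> - r, y = \<tau> - s, z = r - s for the two roots r and
        s, where the numerator z - y + x vanishes.\<close>
      have sum_recip: "1 / (x * y) - 1 / (x * z) + 1 / (y * z) = (z - y + x) / (x * y * z)"
        if "x \<noteq> 0" "y \<noteq> 0" "z \<noteq> 0" for x y z :: complex
        using that by (simp add: divide_simps)
      have "(?r - \<tau>) * (?r - ?s) = - ((\<tau> - ?r) * (?r - ?s))"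
        "(?s - \<tau>) * (?s - ?r) = (\<tau> - ?s) * (?r - ?s)"
        by (simp_all add: algebra_simps)
      then have c12: "c\<^sub>1 = - 1 / ((\<tau> - ?r) * (?r - ?s))" "c\<^sub>2 = 1 / ((\<tau> - ?s) * (?r - ?s))"
        by (simp_all add: c\<^sub>1_def c\<^sub>2_def)
      then show 0: "c\<^sub>0 + c\<^sub>1 + c\<^sub>2 = 0"
        using sum_recip[of "\<tau> - ?r" "\<tau> - ?s" "?r - ?s"] ne by (simp add: c\<^sub>0_def)
      have "c\<^sub>0 * \<tau> + c\<^sub>1 * ?r + c\<^sub>2 * ?s =
          \<tau> * (c\<^sub>0 + c\<^sub>1 + c\<^sub>2) - c\<^sub>1 * (\<tau> - ?r) - c\<^sub>2 * (\<tau> - ?s)"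
        by (simp add: algebra_simps)
      also have "\<dots> = 0"
        unfolding 0 unfolding c12 using ne by simp
      finally show "c\<^sub>0 * \<tau> + c\<^sub>1 * ?r + c\<^sub>2 * ?s = 0" .
    qed
    \<comment> \<open>The characteristic polynomial vanishes at both roots, and its value at \<tau>
      is the reciprocal of \<open>c\<^sub>0\<close>, so only the input remains.\<close>
    have G_ode: "G 2 t = exp (\<tau> * of_real t) - of_real \<gamma> * G 1 t - of_real l * G 0 t" for t
    proof -
      have 0: "z\<^sup>2 + of_real \<gamma> * z + of_real l = (z - ?r) * (z - ?s)" for z
        by (rule char_poly_factor)
      have "G 2 t + of_real \<gamma> * G 1 t + of_real l * G 0 t =
          c\<^sub>0 * (\<tau>\<^sup>2 + of_real \<gamma> * \<tau> + of_real l) * exp (\<tau> * of_real t)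
          + c\<^sub>1 * (?r\<^sup>2 + of_real \<gamma> * ?r + of_real l) * exp (?r * of_real t)
          + c\<^sub>2 * (?s\<^sup>2 + of_real \<gamma> * ?s + of_real l) * exp (?s * of_real t)"
        by (simp add: G_def algebra_simps)
      also have "\<dots> = exp (\<tau> * of_real t)"
        unfolding 0 using ne by (simp add: c\<^sub>0_def)
      finally show ?thesis by (simp add: algebra_simps)
    qed
    let ?s' = "\<lambda>t::real. exp (\<tau> * of_real t) \<cdot>\<^sub>v map_vec complex_of_real (diag_powr M (1/2) *\<^sub>v v)"
    obtain P where resp: "zero_state_response M (\<gamma> \<cdot>\<^sub>m M) B C ?s' (\<lambda>t. G 1 t \<cdot>\<^sub>v u) P"
      unfolding u_def
      using modal_response[OF M B C v(1) eig, of "G 1" "\<lambda>t. exp (\<tau> * of_real t)" \<gamma> "G 0"]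
        G_deriv[of 1] G_deriv[of 0] G_ode sums
      by (simp add: G_def[of _ 0] numeral_2_eq_2)
    have DM: "\<gamma> \<cdot>\<^sub>m M \<in> carrier_mat n n"
      using M by (simp add: pos_diagonal_mat_def)
    have unique: "\<omega> t = G 1 t \<cdot>\<^sub>v u"
      if "zero_state_response M (\<gamma> \<cdot>\<^sub>m M) B C ?s' \<omega> P'" "t \<ge> 0" for \<omega> P' t
      using zero_state_response_unique[OF M C DM that(1) resp that(2)] .
    \<comment> \<open>\<open>resp\<close> settles existence, and \<open>unique\<close> reduces the
      quantifier over all responses to the explicit one.\<close>
    have "?L \<longleftrightarrow> (\<exists>a b. \<forall>t\<ge>0. G 1 t \<cdot>\<^sub>v u = (H \<tau> * exp (\<tau> * of_real t)) \<cdot>\<^sub>v u +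
                      (a * exp (?r * of_real t) + b * exp (?s * of_real t)) \<cdot>\<^sub>v u)"
      unfolding Let_def u_def[symmetric] using resp unique by (metis (lifting))
    also have "\<dots> \<longleftrightarrow> (\<exists>a b. \<forall>t\<ge>0. G 1 t = H \<tau> * exp (\<tau> * of_real t) +
                      a * exp (?r * of_real t) + b * exp (?s * of_real t))"
    proof -
      have "x \<cdot>\<^sub>v u = y \<cdot>\<^sub>v u + z \<cdot>\<^sub>v u \<longleftrightarrow> x = y + z" for x y z
      proof
        assume "x \<cdot>\<^sub>v u = y \<cdot>\<^sub>v u + z \<cdot>\<^sub>v u"
        then have "(x \<cdot>\<^sub>v u) $ j = (y \<cdot>\<^sub>v u + z \<cdot>\<^sub>v u) $ j" by simp
        then have "x * u $ j = (y + z) * u $ j" using u j by (simp add: algebra_simps)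
        then show "x = y + z" using uj by simp
      qed (simp add: add_smult_distrib_vec)
      then show ?thesis by (simp add: add.assoc)
    qed
    also have "\<dots> \<longleftrightarrow> H \<tau> = c\<^sub>0 * \<tau>"
    proof
      assume "H \<tau> = c\<^sub>0 * \<tau>"
      then show "\<exists>a b. \<forall>t\<ge>0. G 1 t = H \<tau> * exp (\<tau> * of_real t) +
                      a * exp (?r * of_real t) + b * exp (?s * of_real t)"
        \<comment> \<open>The transient coefficients are read off from \<open>G 1\<close>.\<close>
        by (intro exI[of _ "c\<^sub>1 * ?r"] exI[of _ "c\<^sub>2 * ?s"]) (simp add: G_def)
    next
      assume "\<exists>a b. \<forall>t\<ge>0. G 1 t = H \<tau> * exp (\<tau> * of_real t) +
                      a * exp (?r * of_real t) + b * exp (?s * of_real t)"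
      then obtain a b where eq: "\<And>t. t \<ge> 0 \<Longrightarrow> G 1 t = H \<tau> * exp (\<tau> * of_real t) +
                      a * exp (?r * of_real t) + b * exp (?s * of_real t)" by blast
      \<comment> \<open>Subtracting the two expansions of \<open>G 1\<close> gives a vanishing
        combination of exponentials; \<tau> differs from both roots, so its coefficient must be
        zero.\<close>
      have "H \<tau> - c\<^sub>0 * \<tau> = 0"
      proof (rule three_exp_independent[OF ne(1,2)])
        show "(H \<tau> - c\<^sub>0 * \<tau>) * exp (\<tau> * of_real t) + (a - c\<^sub>1 * ?r) * exp (?r * of_real t)
            + (b - c\<^sub>2 * ?s) * exp (?s * of_real t) = 0" if "t > 0" for t :: real
          using eq[of t] that by (simp add: G_def algebra_simps)
      qed
      then show "H \<tau> = c\<^sub>0 * \<tau>" by simp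
    qed
    finally show ?thesis by (simp add: c\<^sub>0_def)
  qed
  then show ?thesis
    unfolding is_spectral_transfer_function_def char_poly_factor by blast
qed

section \<open>Application to the modes of the network\<close>

theorem mainTheorem3:
  fixes n m :: nat
    and G :: "(nat, nat) pre_digraph"
    and C M D B :: "real mat"
    and \<gamma> :: real
    and l :: "nat \<Rightarrow> real"
    and v :: "nat \<Rightarrow> real vec"
    and i :: nat
  assumes "oriented_simple_graph n m G"
    and "Digraph_Component.connected G"
    and "C = incidence_mat n m G"
    and "pos_diagonal_mat n M"
    and "pos_diagonal_mat m B"
    and "\<gamma> > 0"
    and "D = \<gamma> \<cdot>\<^sub>m M"
    and "\<And>j. j \<in> {1..n} \<Longrightarrow> eigenvector (scaled_laplacian M B C) (v j) (l j)"
    and "\<And>j k. j \<in> {1..n} \<Longrightarrow> k \<in> {1..n} \<Longrightarrow> scalar_prod (v j) (v k) = (if j = k then 1 else 0)"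
    and "l 1 = 0"
    and "\<And>j. j \<in> {2..n} \<Longrightarrow> 0 < l j"
    and "\<And>j k. j \<in> {1..n} \<Longrightarrow> k \<in> {1..n} \<Longrightarrow> j \<le> k \<Longrightarrow> l j \<le> l k"
    and "i \<in> {1..n}"
    and "\<gamma>\<^sup>2 - 4 * l i \<noteq> 0"
  shows "\<forall>H :: complex \<Rightarrow> complex.
           is_spectral_transfer_function M D B C \<gamma> (l i) (v i) H \<longleftrightarrow>
           (\<forall>\<tau>. \<tau>\<^sup>2 + of_real \<gamma> * \<tau> + of_real (l i) \<noteq> 0 \<longrightarrow>
                H \<tau> = \<tau> / (\<tau>\<^sup>2 + of_real \<gamma> * \<tau> + of_real (l i)))"
proof (intro allI)
  fix H :: "complex \<Rightarrow> complex"
  have "B \<in> carrier_mat m m" using assms(5) by (simp add: pos_diagonal_mat_def)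
  moreover have "C \<in> carrier_mat n m" using assms(3) by (simp add: incidence_mat_def)
  moreover have "eigenvector (scaled_laplacian M B C) (v i) (l i)" using assms(8,13) .
  ultimately show "is_spectral_transfer_function M D B C \<gamma> (l i) (v i) H \<longleftrightarrow>
      (\<forall>\<tau>. \<tau>\<^sup>2 + of_real \<gamma> * \<tau> + of_real (l i) \<noteq> 0 \<longrightarrow>
        H \<tau> = \<tau> / (\<tau>\<^sup>2 + of_real \<gamma> * \<tau> + of_real (l i)))"
    unfolding assms(7) using assms(4,14) by (intro spectral_transfer_function_iff)
qed

end
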